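(* Let $\Gamma=(V,\rho,a,B)$ be a finite network. If $\operatorname{Re}\lambda>0$ then $$|\mathcal{P}(\lambda)|\le\frac{|\lambda|^{2}}{(\operatorname{Re}\lambda)^{2}}\sum_{x\sim a}\left|\rho_{xa}^{(\lambda)}\right|.$$
   Context: Let $(V,E)$ be a finite connected undirected graph with $|V|\ge2$, edges being unordered pairs $xy$ of vertices; $x\sim y$ means $xy\in E$. Each edge $xy\in E$ carries real numbers $R_{xy},L_{xy},D_{xy}\in[0,+\infty)$ with $R_{xy}+L_{xy}+D_{xy}>0$. For $\lambda\in\mathbb{C}\setminus\{0\}$ put $z_{xy}^{(\lambda)}=R_{xy}+L_{xy}\lambda+\frac{D_{xy}}{\lambda}$ (impedance) and $\rho_{xy}^{(\lambda)}=1/z_{xy}^{(\lambda)}$ (admittance); set $\rho_{xy}^{(\lambda)}=0$ if $x\not\sim y$. Let $\Lambda$ be the set of those $\lambda\in\mathbb{C}\setminus\{0\}$ with $L_{xy}\lambda^2+R_{xy}\lambda+D_{xy}\ne0$ for all $xy\in E$; $\Lambda\supset\{\operatorname{Re}\lambda>0\}$. Fix $a\in V$ and a non-empty $B\subset V$ with $a\notin B$; put $B_0=B\cup\{a\}$. The structure $\Gamma=(V,\rho,a,B)$ is called a finite network. For $\lambda\in\Lambda$ and $f:V\to\mathbb{C}$ put $\Delta_\rho f(x)=\sum_{y\in V}(f(y)-f(x))\rho_{xy}^{(\lambda)}$. The Dirichlet problem for $v:V\to\mathbb{C}$ is: $\Delta_\rho v(x)=0$ for $x\in V\setminus B_0$,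 $v(x)=0$ for $x\in B$, $v(a)=1$. The effective admittance of $\Gamma$ is $\mathcal{P}(\lambda)=\sum_{x\in V}(1-v(x))\rho_{xa}^{(\lambda)}$ where $v$ is any solution of the Dirichlet problem (the value does not depend on the choice of the solution); if there is no solution, $\mathcal{P}(\lambda)=\infty$. *)

theory Defs
  imports "HOL-Analysis.Analysis"
begin

text \<open>
  An edge is a two-element set of vertices, so the graph is simple and undirected, and the weights,
  being functions of the edge, are symmetric in its endpoints. Values of the weights outside
  the edge set are irrelevant. The field \<open>elastance\<close> is the coefficient \<open>D\<close> (the inverse capacity).
\<close>

record 'v network =
  verts :: "'v set"
  edges :: "'v set set"
  resistance :: "'v set \<Rightarrow> real"
  inductance :: "'v set \<Rightarrow> real"
  elastance :: "'v set \<Rightarrow> real"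
  source :: 'v
  ground :: "'v set"

definition adjacent :: "('v, 'm) network_scheme \<Rightarrow> 'v \<Rightarrow> 'v \<Rightarrow> bool" where
  "adjacent \<Gamma> x y \<longleftrightarrow> {x, y} \<in> edges \<Gamma>"

locale finite_network =
  fixes \<Gamma> :: "('v, 'm) network_scheme"
  assumes finite_verts: "finite (verts \<Gamma>)"
    and card_verts: "card (verts \<Gamma>) \<ge> 2"
    and edges_pairs: "e \<in> edges \<Gamma> \<Longrightarrow> \<exists>x\<in>verts \<Gamma>. \<exists>y\<in>verts \<Gamma>. x \<noteq> y \<and> e = {x, y}"
    and connected_verts: "x \<in> verts \<Gamma> \<Longrightarrow> y \<in> verts \<Gamma> \<Longrightarrow> (adjacent \<Gamma>)\<^sup>*\<^sup>* x y"
    and resistance_nonneg: "e \<in> edges \<Gamma> \<Longrightarrow> resistance \<Gamma> e \<ge> 0"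
    and inductance_nonneg: "e \<in> edges \<Gamma> \<Longrightarrow> inductance \<Gamma> e \<ge> 0"
    and elastance_nonneg: "e \<in> edges \<Gamma> \<Longrightarrow> elastance \<Gamma> e \<ge> 0"
    and weights_pos: "e \<in> edges \<Gamma> \<Longrightarrow> resistance \<Gamma> e + inductance \<Gamma> e + elastance \<Gamma> e > 0"
    and source_in_verts: "source \<Gamma> \<in> verts \<Gamma>"
    and ground_subset: "ground \<Gamma> \<subseteq> verts \<Gamma>"
    and ground_nonempty: "ground \<Gamma> \<noteq> {}"
    and source_notin_ground: "source \<Gamma> \<notin> ground \<Gamma>"

definition impedance :: "('v, 'm) network_scheme \<Rightarrow> complex \<Rightarrow> 'v set \<Rightarrow> complex" where
  "impedance \<Gamma> s e =
    of_real (resistance \<Gamma> e) + of_real (inductance \<Gamma> e) * s + of_real (elastance \<Gamma> e) / s"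

text \<open>
  The following notions are meant for \<open>s\<close> in the set \<open>regular_set\<close> below, where no impedance of an
  edge vanishes; elsewhere they carry the arbitrary values produced by division by zero.
\<close>

definition regular_set :: "('v, 'm) network_scheme \<Rightarrow> complex set" where
  "regular_set \<Gamma> = {s. s \<noteq> 0 \<and> (\<forall>e\<in>edges \<Gamma>.
     of_real (inductance \<Gamma> e) * s\<^sup>2 + of_real (resistance \<Gamma> e) * s + of_real (elastance \<Gamma> e) \<noteq> 0)}"

definition admittance :: "('v, 'm) network_scheme \<Rightarrow> complex \<Rightarrow> 'v \<Rightarrow> 'v \<Rightarrow> complex" where
  "admittance \<Gamma> s x y = (if adjacent \<Gamma> x y then 1 / impedance \<Gamma> s {x, y} else 0)"

definition laplacian ::
  "('v, 'm) network_scheme \<Rightarrow> complex \<Rightarrow> ('v \<Rightarrow> complex) \<Rightarrow> 'v \<Rightarrow> complex" where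
  "laplacian \<Gamma> s f x = (\<Sum>y\<in>verts \<Gamma>. (f y - f x) * admittance \<Gamma> s x y)"

definition dirichlet_solution ::
  "('v, 'm) network_scheme \<Rightarrow> complex \<Rightarrow> ('v \<Rightarrow> complex) \<Rightarrow> bool" where
  "dirichlet_solution \<Gamma> s v \<longleftrightarrow>
     (\<forall>x \<in> verts \<Gamma> - (ground \<Gamma> \<union> {source \<Gamma>}). laplacian \<Gamma> s v x = 0) \<and>
     (\<forall>x \<in> ground \<Gamma>. v x = 0) \<and>
     v (source \<Gamma>) = 1"

definition source_flow :: "('v, 'm) network_scheme \<Rightarrow> complex \<Rightarrow> ('v \<Rightarrow> complex) \<Rightarrow> complex" where
  "source_flow \<Gamma> s v = (\<Sum>x\<in>verts \<Gamma>. (1 - v x) * admittance \<Gamma> s x (source \<Gamma>))"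

datatype ext_complex = Finite complex | Infinite

primrec ext_cmod :: "ext_complex \<Rightarrow> ereal" where
  "ext_cmod (Finite z) = ereal (cmod z)"
| "ext_cmod Infinite = \<infinity>"

text \<open>
  The choice of the solution is immaterial: see \<open>effective_admittance_eq\<close> below.
\<close>

definition effective_admittance :: "('v, 'm) network_scheme \<Rightarrow> complex \<Rightarrow> ext_complex" where
  "effective_admittance \<Gamma> s =
     (if \<exists>v. dirichlet_solution \<Gamma> s v
      then Finite (source_flow \<Gamma> s (SOME v. dirichlet_solution \<Gamma> s v))
      else Infinite)"

lemma adjacent_commute: "adjacent \<Gamma> x y = adjacent \<Gamma> y x"
  by (simp add: adjacent_def insert_commute)

lemma admittance_commute: "admittance \<Gamma> s x y = admittance \<Gamma> s y x"
  by (simp add: admittance_def adjacent_commute[of \<Gamma> x y] insert_commute)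

lemma impedance_times:
  assumes "s \<noteq> 0"
  shows "impedance \<Gamma> s e * s =
    of_real (inductance \<Gamma> e) * s\<^sup>2 + of_real (resistance \<Gamma> e) * s + of_real (elastance \<Gamma> e)"
  using assms by (simp add: impedance_def field_simps power2_eq_square)

lemma impedance_nonzero:
  assumes "s \<in> regular_set \<Gamma>" "e \<in> edges \<Gamma>"
  shows "impedance \<Gamma> s e \<noteq> 0"
  using assms impedance_times[of s \<Gamma> e] by (auto simp: regular_set_def)

context finite_network
begin

lemma Re_impedance_pos:
  assumes "Re s > 0" "e \<in> edges \<Gamma>"
  shows "Re (impedance \<Gamma> s e) > 0"
proof -
  define c where "c = Re s / (cmod s)\<^sup>2"
  have "s \<noteq> 0" using assms(1) by auto
  then have c: "c > 0" using assms(1) by (simp add: c_def)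
  have eq: "Re (impedance \<Gamma> s e) =
      resistance \<Gamma> e + inductance \<Gamma> e * Re s + elastance \<Gamma> e * c"
    by (simp add: impedance_def c_def Re_divide cmod_power2)
  note nonneg = resistance_nonneg[OF assms(2)] inductance_nonneg[OF assms(2)]
    elastance_nonneg[OF assms(2)]
  have prods: "inductance \<Gamma> e * Re s \<ge> 0" "elastance \<Gamma> e * c \<ge> 0"
    using nonneg assms(1) c by simp_all
  consider "resistance \<Gamma> e > 0" | "inductance \<Gamma> e > 0" | "elastance \<Gamma> e > 0"
    using weights_pos[OF assms(2)] nonneg by linarith
  then show ?thesis
  proof cases
    case 1
    then show ?thesis using eq prods by linarith
  next
    case 2
    then have "inductance \<Gamma> e * Re s > 0" using assms(1) by simp
    then show ?thesis using eq prods nonneg by linarith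
  next
    case 3
    then have "elastance \<Gamma> e * c > 0" using c by simp
    then show ?thesis using eq prods nonneg by linarith
  qed
qed

lemma right_half_plane_regular:
  assumes "Re s > 0"
  shows "s \<in> regular_set \<Gamma>"
proof -
  have "s \<noteq> 0" using assms by auto
  moreover have "impedance \<Gamma> s e * s \<noteq> 0" if "e \<in> edges \<Gamma>" for e
    using Re_impedance_pos[OF assms that] \<open>s \<noteq> 0\<close> by auto
  ultimately show ?thesis by (simp add: regular_set_def impedance_times)
qed

lemma laplacian_symmetric:
  "(\<Sum>x\<in>verts \<Gamma>. laplacian \<Gamma> s f x * g x) = (\<Sum>x\<in>verts \<Gamma>. laplacian \<Gamma> s g x * f x)"
proof -
  let ?V = "verts \<Gamma>"
  let ?p = "admittance \<Gamma> s"
  have expand: "(\<Sum>x\<in>?V. laplacian \<Gamma> s f x * g x) =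
      (\<Sum>x\<in>?V. \<Sum>y\<in>?V. f y * g x * ?p x y) - (\<Sum>x\<in>?V. \<Sum>y\<in>?V. f x * g x * ?p x y)" for f g
    by (simp add: laplacian_def sum_distrib_left sum_distrib_right sum_subtractf[symmetric]
        algebra_simps)
  have "(\<Sum>x\<in>?V. \<Sum>y\<in>?V. f y * g x * ?p x y) = (\<Sum>x\<in>?V. \<Sum>y\<in>?V. g y * f x * ?p x y)"
    by (subst sum.swap) (simp add: admittance_commute[of \<Gamma> s] mult.commute)
  then show ?thesis
    unfolding expand[of f g] expand[of g f] by (simp add: mult.commute)
qed

lemma source_flow_eq_laplacian:
  assumes "v (source \<Gamma>) = 1"
  shows "source_flow \<Gamma> s v = - laplacian \<Gamma> s v (source \<Gamma>)"
  using assms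
  by (simp add: source_flow_def laplacian_def admittance_commute[of \<Gamma> s "source \<Gamma>"]
      sum_negf[symmetric] algebra_simps)

lemma source_flow_unique:
  assumes "dirichlet_solution \<Gamma> s v" "dirichlet_solution \<Gamma> s w"
  shows "source_flow \<Gamma> s v = source_flow \<Gamma> s w"
proof -
  have pairing: "(\<Sum>x\<in>verts \<Gamma>. laplacian \<Gamma> s f x * g x) = laplacian \<Gamma> s f (source \<Gamma>)"
    if "dirichlet_solution \<Gamma> s f" "dirichlet_solution \<Gamma> s g" for f g
  proof -
    have "(\<Sum>x\<in>verts \<Gamma>. laplacian \<Gamma> s f x * g x) =
        (\<Sum>x\<in>{source \<Gamma>}. laplacian \<Gamma> s f x * g x)"
      using that finite_verts source_in_verts
      by (intro sum.mono_neutral_right) (auto simp: dirichlet_solution_def)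
    then show ?thesis using that by (simp add: dirichlet_solution_def)
  qed
  have "laplacian \<Gamma> s v (source \<Gamma>) = laplacian \<Gamma> s w (source \<Gamma>)"
    using pairing[OF assms] pairing[OF assms(2,1)] laplacian_symmetric[of s v w] by simp
  then show ?thesis
    using assms by (simp add: source_flow_eq_laplacian dirichlet_solution_def)
qed

lemma effective_admittance_eq:
  assumes "dirichlet_solution \<Gamma> s v"
  shows "effective_admittance \<Gamma> s = Finite (source_flow \<Gamma> s v)"
proof -
  have "dirichlet_solution \<Gamma> s (SOME v. dirichlet_solution \<Gamma> s v)"
    using assms by (rule someI[of "dirichlet_solution \<Gamma> s"])
  then show ?thesis
    using assms by (auto simp: effective_admittance_def intro: source_flow_unique)
qed

end

end

theory Submission
  imports Defs
begin

text \<open>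
  Write \<open>c = Re s / cmod s\<close>, which is the cosine of the absolute value \<open>\<theta>\<close> of the argument of
  \<open>s\<close>. An impedance is a combination of \<open>1\<close>, \<open>s\<close> and \<open>1 / s\<close> with nonnegative coefficients, so its argument lies between \<open>-\<theta>\<close> and
  \<open>\<theta>\<close>, and the same holds for its inverse. Hence every admittance \<open>\<rho>\<close> satisfies
  \<open>c * cmod \<rho> \<le> Re \<rho>\<close> (\<open>cmod_admittance_le_Re\<close>).

  Summation by parts turns the pairing of \<open>laplacian \<Gamma> s f\<close> with the conjugate of \<open>f\<close> into minus the
  sum of \<open>\<rho> x y * (cmod (f y - f x))\<^sup>2\<close> over the edges. By the estimate on \<open>\<rho>\<close> its real part
  controls the nonnegative energy of \<open>f\<close> with weights \<open>cmod \<rho>\<close> (\<open>energy_le_laplacian\<close>). This is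
  used twice.

  First, let a function be \<open>1\<close> at a vertex \<open>p\<close>, have at least one zero, and be harmonic at every
  vertex other than \<open>p\<close> and its zeros. Its energy is positive because the graph is connected, so
  its Laplacian at \<open>p\<close> does not vanish (\<open>laplacian_nonzero_at_pole\<close>). This makes it possible to
  extend boundary values harmonically to one more vertex at a time
  (\<open>harmonic_extension_exists\<close>), so that the Dirichlet problem has a solution \<open>v\<close> and the
  effective admittance \<open>P\<close> is finite.

  Second, for that \<open>v\<close> the pairing is \<open>- P\<close>, so \<open>T\<close>, the part of the energy that is carried by the
  edges at the source, satisfies \<open>c * T \<le> Re P\<close>. On the other hand \<open>P\<close> is the sum of
  \<open>(1 - v x) * \<rho>\<close> over these same edges, and the Cauchy--Schwarz inequality gives
  \<open>(cmod P)\<^sup>2 \<le> S * T\<close> with \<open>S\<close> the sum of the \<open>cmod \<rho>\<close>. Together, \<open>c * cmod P \<le> S\<close>, and the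
  assertion follows because \<open>c \<le> 1\<close>.
\<close>

text \<open>
  The sum over ordered pairs counts every edge twice, and the modulus of the admittance makes the
  energy a nonnegative quadratic form although the admittances are complex.
\<close>

definition energy ::
  "('v, 'm) network_scheme \<Rightarrow> complex \<Rightarrow> ('v \<Rightarrow> complex) \<Rightarrow> real" where
  "energy \<Gamma> s f =
    (\<Sum>x\<in>verts \<Gamma>. \<Sum>y\<in>verts \<Gamma>. (cmod (f y - f x))\<^sup>2 * cmod (admittance \<Gamma> s x y)) / 2"

lemma laplacian_add_scaled:
  "laplacian \<Gamma> s (\<lambda>x. f x + k * g x) x = laplacian \<Gamma> s f x + k * laplacian \<Gamma> s g x"
  by (simp add: laplacian_def sum_distrib_left sum.distrib[symmetric] algebra_simps)

context finite_network
begin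

section \<open>Admittances in the right half-plane\<close>

lemma cmod_impedance_le_Re:
  assumes s: "Re s > 0" and e: "e \<in> edges \<Gamma>"
  shows "Re s / cmod s * cmod (impedance \<Gamma> s e) \<le> Re (impedance \<Gamma> s e)"
proof -
  let ?c = "Re s / cmod s"
  note nonneg = resistance_nonneg[OF e] inductance_nonneg[OF e] elastance_nonneg[OF e]
  have pos: "cmod s > 0" using s by auto
  have c: "0 \<le> ?c" "?c \<le> 1" using s pos complex_Re_le_cmod[of s] by simp_all
  have "cmod (impedance \<Gamma> s e) \<le>
      resistance \<Gamma> e + inductance \<Gamma> e * cmod s + elastance \<Gamma> e / cmod s"
    unfolding impedance_def using nonneg
    by (intro order_trans[OF norm_triangle_ineq] add_mono)
       (simp_all add: norm_mult norm_divide)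
  then have "?c * cmod (impedance \<Gamma> s e) \<le>
      ?c * (resistance \<Gamma> e + inductance \<Gamma> e * cmod s + elastance \<Gamma> e / cmod s)"
    using c(1) by (rule mult_left_mono)
  also have "\<dots> = ?c * resistance \<Gamma> e + inductance \<Gamma> e * Re s
      + elastance \<Gamma> e * (Re s / (cmod s)\<^sup>2)"
    using pos by (simp add: field_simps power2_eq_square)
  also have "\<dots> \<le> resistance \<Gamma> e + inductance \<Gamma> e * Re s + elastance \<Gamma> e * (Re s / (cmod s)\<^sup>2)"
    by (intro add_right_mono mult_left_le_one_le nonneg c)
  also have "\<dots> = Re (impedance \<Gamma> s e)"
    by (simp add: impedance_def Re_divide cmod_power2)
  finally show ?thesis .
qed

text \<open>Inversion reflects the sector \<open>c * cmod z \<le> Re z\<close> in the real axis, hence preserves it.\<close>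

lemma cmod_admittance_le_Re:
  assumes "Re s > 0"
  shows "Re s / cmod s * cmod (admittance \<Gamma> s x y) \<le> Re (admittance \<Gamma> s x y)"
proof (cases "adjacent \<Gamma> x y")
  case True
  define z where "z = impedance \<Gamma> s {x, y}"
  have e: "{x, y} \<in> edges \<Gamma>" using True by (simp add: adjacent_def)
  have "z \<noteq> 0" using Re_impedance_pos[OF assms e] by (auto simp: z_def)
  then have "Re s / cmod s * cmod (1 / z) = Re s / cmod s * cmod z / (cmod z)\<^sup>2"
    by (simp add: norm_divide power2_eq_square)
  also have "\<dots> \<le> Re z / (cmod z)\<^sup>2"
    using cmod_impedance_le_Re[OF assms e] by (intro divide_right_mono) (simp_all add: z_def)
  also have "\<dots> = Re (1 / z)" by (simp add: Re_divide cmod_power2)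
  finally show ?thesis using True by (simp add: admittance_def z_def)
qed (simp add: admittance_def)

lemma admittance_nonzero:
  assumes "Re s > 0" "adjacent \<Gamma> x y"
  shows "admittance \<Gamma> s x y \<noteq> 0"
  using impedance_nonzero[OF right_half_plane_regular[OF assms(1)]] assms(2)
  by (simp add: admittance_def adjacent_def)

lemma adjacent_verts:
  assumes "adjacent \<Gamma> x y"
  shows "x \<in> verts \<Gamma>" "y \<in> verts \<Gamma>"
  using edges_pairs[of "{x, y}"] assms by (auto simp: adjacent_def doubleton_eq_iff)

section \<open>Energy\<close>

lemma laplacian_cnj_pairing:
  "(\<Sum>x\<in>verts \<Gamma>. laplacian \<Gamma> s f x * cnj (f x)) =
    - (\<Sum>x\<in>verts \<Gamma>. \<Sum>y\<in>verts \<Gamma>. of_real ((cmod (f y - f x))\<^sup>2) * admittance \<Gamma> s x y) / 2"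
proof -
  let ?V = "verts \<Gamma>"
  let ?p = "admittance \<Gamma> s"
  define A where "A = (\<Sum>x\<in>?V. \<Sum>y\<in>?V. (f y - f x) * cnj (f x) * ?p x y)"
  define B where "B = (\<Sum>x\<in>?V. \<Sum>y\<in>?V. of_real ((cmod (f y - f x))\<^sup>2) * ?p x y)"
  have pairing: "(\<Sum>x\<in>?V. laplacian \<Gamma> s f x * cnj (f x)) = A"
    by (simp add: A_def laplacian_def sum_distrib_left sum_distrib_right algebra_simps)
  have swapped: "A = (\<Sum>x\<in>?V. \<Sum>y\<in>?V. (f x - f y) * cnj (f y) * ?p x y)"
    unfolding A_def by (subst sum.swap) (simp add: admittance_commute[of \<Gamma> s])
  have "A + A = (\<Sum>x\<in>?V. \<Sum>y\<in>?V.
      (f y - f x) * cnj (f x) * ?p x y + (f x - f y) * cnj (f y) * ?p x y)"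
    by (subst (2) swapped) (simp add: A_def sum.distrib)
  also have "\<dots> = - B"
    unfolding B_def sum_negf[symmetric] complex_norm_square
    by (intro sum.cong refl) (simp add: algebra_simps)
  finally have "A = - B / 2" by (simp add: field_simps)
  then show ?thesis unfolding pairing B_def .
qed

text \<open>
  At every vertex but \<open>p\<close> the pairing has a vanishing factor, the Laplacian in the interior and the
  function itself on the boundary, so only the Laplacian at \<open>p\<close> survives.
\<close>

lemma energy_le_laplacian:
  assumes s: "Re s > 0" and p: "p \<in> verts \<Gamma>" "f p = 1"
    and off: "\<And>x. x \<in> verts \<Gamma> \<Longrightarrow> x \<noteq> p \<Longrightarrow> laplacian \<Gamma> s f x = 0 \<or> f x = 0"
  shows "Re s / cmod s * energy \<Gamma> s f \<le> - Re (laplacian \<Gamma> s f p)"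
proof -
  let ?V = "verts \<Gamma>"
  let ?p = "admittance \<Gamma> s"
  let ?c = "Re s / cmod s"
  have "(\<Sum>x\<in>?V. laplacian \<Gamma> s f x * cnj (f x)) = (\<Sum>x\<in>{p}. laplacian \<Gamma> s f x * cnj (f x))"
    using p off finite_verts by (intro sum.mono_neutral_right) auto
  then have lap: "laplacian \<Gamma> s f p =
      - (\<Sum>x\<in>?V. \<Sum>y\<in>?V. of_real ((cmod (f y - f x))\<^sup>2) * ?p x y) / 2"
    unfolding laplacian_cnj_pairing using p by simp
  have "?c * energy \<Gamma> s f =
      (\<Sum>x\<in>?V. \<Sum>y\<in>?V. (cmod (f y - f x))\<^sup>2 * (?c * cmod (?p x y))) / 2"
    by (simp add: energy_def sum_distrib_left mult.left_commute)
  also have "\<dots> \<le> (\<Sum>x\<in>?V. \<Sum>y\<in>?V. (cmod (f y - f x))\<^sup>2 * Re (?p x y)) / 2"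
    using cmod_admittance_le_Re[OF s]
    by (intro divide_right_mono sum_mono mult_left_mono) simp_all
  also have "\<dots> = - Re (laplacian \<Gamma> s f p)"
    unfolding lap by (simp flip: of_real_power)
  finally show ?thesis .
qed

lemma energy_nonneg: "energy \<Gamma> s f \<ge> 0"
  by (simp add: energy_def sum_nonneg)

lemma energy_eq_0_imp_constant:
  assumes s: "Re s > 0" and zero: "energy \<Gamma> s f = 0"
    and xy: "x \<in> verts \<Gamma>" "y \<in> verts \<Gamma>"
  shows "f x = f y"
proof -
  have "\<forall>u\<in>verts \<Gamma>. (\<Sum>v\<in>verts \<Gamma>. (cmod (f v - f u))\<^sup>2 * cmod (admittance \<Gamma> s u v)) = 0"
    using zero finite_verts by (simp add: energy_def sum_nonneg sum_nonneg_eq_0_iff)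
  then have "\<forall>u\<in>verts \<Gamma>. \<forall>v\<in>verts \<Gamma>. (cmod (f v - f u))\<^sup>2 * cmod (admittance \<Gamma> s u v) = 0"
    using finite_verts by (simp add: sum_nonneg_eq_0_iff)
  then have edge: "f u = f v" if "adjacent \<Gamma> u v" for u v
    using that adjacent_verts[OF that] admittance_nonzero[OF s that] by fastforce
  have "(adjacent \<Gamma>)\<^sup>*\<^sup>* x y" using xy by (rule connected_verts)
  then show ?thesis by (induction rule: rtranclp_induct) (auto dest: edge)
qed

text \<open>
  The left-hand side contains each edge at \<open>a\<close> once. Both orientations of such an edge occur among
  the ordered pairs that define the energy, which compensates the division by two.
\<close>

lemma energy_at_vertex_le:
  assumes a: "a \<in> verts \<Gamma>"
  shows "(\<Sum>x\<in>verts \<Gamma>. (cmod (f a - f x))\<^sup>2 * cmod (admittance \<Gamma> s x a)) \<le> energy \<Gamma> s f"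
proof -
  let ?V = "verts \<Gamma>"
  define w where "w x y = (cmod (f y - f x))\<^sup>2 * cmod (admittance \<Gamma> s x y)" for x y
  have w: "w x y \<ge> 0" "w x y = w y x" "w x x = 0" for x y
    by (simp_all add: w_def admittance_commute[of \<Gamma> s x y] norm_minus_commute)
  \<comment> \<open>The diagonal pair would be counted in both orientations at once, but its weight vanishes.\<close>
  have star: "(\<Sum>x\<in>?V. w x a) = (\<Sum>x\<in>?V - {a}. w x a)"
    using a finite_verts w(3) by (simp add: sum.remove)
  have "(\<Sum>x\<in>?V. w x a) + (\<Sum>x\<in>?V. w x a) = (\<Sum>y\<in>?V. w a y) + (\<Sum>x\<in>?V - {a}. w x a)"
    by (subst (2) star) (simp add: w(2)[of a])
  also have "\<dots> \<le> (\<Sum>y\<in>?V. w a y) + (\<Sum>x\<in>?V - {a}. \<Sum>y\<in>?V. w x y)"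
    using a finite_verts w(1) by (intro add_left_mono sum_mono member_le_sum) auto
  also have "\<dots> = (\<Sum>x\<in>?V. \<Sum>y\<in>?V. w x y)"
    using a finite_verts by (simp add: sum.remove[of ?V a "\<lambda>x. \<Sum>y\<in>?V. w x y"])
  also have "\<dots> = 2 * energy \<Gamma> s f" by (simp add: energy_def w_def)
  finally show ?thesis by (simp add: w_def)
qed

section \<open>Solvability of the Dirichlet problem\<close>

text \<open>
  A vanishing Laplacian at \<open>p\<close> would make the energy vanish, so \<open>f\<close> would be constant because the
  graph is connected; but it takes both values \<open>1\<close> and \<open>0\<close>.
\<close>

lemma laplacian_nonzero_at_pole:
  assumes s: "Re s > 0" and p: "p \<in> verts \<Gamma>" "f p = 1" and q: "q \<in> verts \<Gamma>" "f q = 0"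
    and off: "\<And>x. x \<in> verts \<Gamma> \<Longrightarrow> x \<noteq> p \<Longrightarrow> laplacian \<Gamma> s f x = 0 \<or> f x = 0"
  shows "laplacian \<Gamma> s f p \<noteq> 0"
proof
  assume "laplacian \<Gamma> s f p = 0"
  then have "Re s / cmod s * energy \<Gamma> s f \<le> 0"
    using energy_le_laplacian[OF s p off] by simp
  moreover have "Re s / cmod s > 0" using s by (intro divide_pos_pos) auto
  ultimately have "energy \<Gamma> s f = 0"
    using energy_nonneg[of s f] unfolding mult_le_0_iff by linarith
  then show False using energy_eq_0_imp_constant[of s f, OF s _ p(1) q(1)] p q by simp
qed

text \<open>
  To make an extension harmonic at a new vertex \<open>p\<close> as well, a multiple of the extension \<open>h\<close> of the
  indicator function of \<open>p\<close> is added, which does not change the boundary values. The multiple is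
  determined by a linear equation whose coefficient is the Laplacian of \<open>h\<close> at \<open>p\<close>; it is
  nonzero because \<open>h\<close> vanishes on the ground.
\<close>

lemma harmonic_extension_exists:
  assumes s: "Re s > 0" and "finite I" and "I \<subseteq> verts \<Gamma> - ground \<Gamma>"
  shows "\<exists>v. (\<forall>x\<in>I. laplacian \<Gamma> s v x = 0) \<and> (\<forall>x. x \<notin> I \<longrightarrow> v x = g x)"
  using assms(2,3)
proof (induction I arbitrary: g rule: finite_induct)
  case empty
  then show ?case by auto
next
  case (insert p I)
  obtain u where u: "\<forall>x\<in>I. laplacian \<Gamma> s u x = 0" "\<forall>x. x \<notin> I \<longrightarrow> u x = g x"
    using insert.IH[of g] insert.prems by auto
  obtain h where h: "\<forall>x\<in>I. laplacian \<Gamma> s h x = 0"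
      "\<forall>x. x \<notin> I \<longrightarrow> h x = (if x = p then 1 else 0)"
    using insert.IH[of "\<lambda>x. if x = p then 1 else 0"] insert.prems by auto
  obtain q where q: "q \<in> ground \<Gamma>" using ground_nonempty by auto
  have "laplacian \<Gamma> s h p \<noteq> 0"
  proof (rule laplacian_nonzero_at_pole[OF s])
    show "p \<in> verts \<Gamma>" "h p = 1" using insert h by auto
    show "q \<in> verts \<Gamma>" "h q = 0" using q ground_subset insert.prems h by auto
    show "laplacian \<Gamma> s h x = 0 \<or> h x = 0" if "x \<noteq> p" for x
      using that h by (cases "x \<in> I") auto
  qed
  then obtain k where "laplacian \<Gamma> s u p + k * laplacian \<Gamma> s h p = 0"
    using that[of "- laplacian \<Gamma> s u p / laplacian \<Gamma> s h p"] by simp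
  then have "\<forall>x\<in>insert p I. laplacian \<Gamma> s (\<lambda>x. u x + k * h x) x = 0"
    using u h by (simp add: laplacian_add_scaled)
  moreover have "\<forall>x. x \<notin> insert p I \<longrightarrow> u x + k * h x = g x"
    using u h by simp
  ultimately show ?case by (intro exI[of _ "\<lambda>x. u x + k * h x"]) blast
qed

lemma dirichlet_solution_exists:
  assumes "Re s > 0"
  shows "\<exists>v. dirichlet_solution \<Gamma> s v"
proof -
  let ?I = "verts \<Gamma> - (ground \<Gamma> \<union> {source \<Gamma>})"
  obtain v where "\<forall>x\<in>?I. laplacian \<Gamma> s v x = 0"
      "\<forall>x. x \<notin> ?I \<longrightarrow> v x = (if x = source \<Gamma> then 1 else 0)"
    using harmonic_extension_exists[OF assms, of ?I "\<lambda>x. if x = source \<Gamma> then 1 else 0"]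
      finite_verts by auto
  then have "dirichlet_solution \<Gamma> s v"
    using source_notin_ground by (auto simp: dirichlet_solution_def)
  then show ?thesis by blast
qed

section \<open>Bound on the flow out of the source\<close>

text \<open>
  The flow is controlled by the square root of the energy, and the energy in turn by the flow.
  Cancelling one power of the flow leaves a bound that does not depend on the solution.
\<close>

lemma cmod_source_flow_le:
  assumes s: "Re s > 0" and v: "dirichlet_solution \<Gamma> s v"
  shows "Re s / cmod s * cmod (source_flow \<Gamma> s v)
    \<le> (\<Sum>x\<in>verts \<Gamma>. cmod (admittance \<Gamma> s x (source \<Gamma>)))"
proof -
  let ?V = "verts \<Gamma>"
  let ?c = "Re s / cmod s"
  define P where "P = source_flow \<Gamma> s v"
  define r where "r x = cmod (admittance \<Gamma> s x (source \<Gamma>))" for x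
  define S where "S = (\<Sum>x\<in>?V. r x)"
  define T where "T = (\<Sum>x\<in>?V. (cmod (1 - v x))\<^sup>2 * r x)"
  have v1: "v (source \<Gamma>) = 1" using v by (simp add: dirichlet_solution_def)
  have r: "r x \<ge> 0" for x by (simp add: r_def)
  have S: "S \<ge> 0" by (simp add: S_def r sum_nonneg)
  have c: "?c \<ge> 0" using s by simp
  have "cmod P \<le> (\<Sum>x\<in>?V. cmod (1 - v x) * r x)"
    unfolding P_def source_flow_def r_def
    by (intro order_trans[OF norm_sum]) (simp add: norm_mult)
  also have "\<dots> = (\<Sum>x\<in>?V. sqrt (r x) * (cmod (1 - v x) * sqrt (r x)))"
    using r by (intro sum.cong refl) (simp add: algebra_simps)
  finally have "(cmod P)\<^sup>2 \<le> (\<Sum>x\<in>?V. sqrt (r x) * (cmod (1 - v x) * sqrt (r x)))\<^sup>2"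
    by (rule power_mono) simp
  also have "\<dots> \<le> (\<Sum>x\<in>?V. (sqrt (r x))\<^sup>2) * (\<Sum>x\<in>?V. (cmod (1 - v x) * sqrt (r x))\<^sup>2)"
    by (rule Cauchy_Schwarz_ineq_sum)
  also have "\<dots> = S * T"
    using r by (simp add: S_def T_def power_mult_distrib)
  finally have CS: "(cmod P)\<^sup>2 \<le> S * T" .
  have "T \<le> energy \<Gamma> s v"
    using energy_at_vertex_le[OF source_in_verts, of v s] by (simp add: T_def r_def v1)
  then have "?c * T \<le> ?c * energy \<Gamma> s v" using c by (rule mult_left_mono)
  also have "\<dots> \<le> - Re (laplacian \<Gamma> s v (source \<Gamma>))"
    using v by (intro energy_le_laplacian s source_in_verts v1)
      (auto simp: dirichlet_solution_def)
  also have "\<dots> = Re P" unfolding P_def source_flow_eq_laplacian[of v, OF v1] by simp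
  also have "\<dots> \<le> cmod P" by (rule complex_Re_le_cmod)
  finally have T: "?c * T \<le> cmod P" .
  have "?c * cmod P * cmod P \<le> ?c * (S * T)"
    using mult_left_mono[OF CS c] by (simp add: power2_eq_square mult.assoc)
  also have "\<dots> \<le> S * cmod P" using mult_left_mono[OF T S] by (simp add: mult.left_commute)
  finally have "?c * cmod P \<le> S"
    using S by (cases "P = 0") (simp, metis mult_right_le_imp_le zero_less_norm_iff)
  then show ?thesis by (simp add: P_def S_def r_def)
qed

end

theorem corollary12:
  fixes \<Gamma> :: "'v network" and s :: complex
  assumes "finite_network \<Gamma>"
    and "Re s > 0"
  shows "ext_cmod (effective_admittance \<Gamma> s)
    \<le> ereal ((cmod s)\<^sup>2 / (Re s)\<^sup>2 *
        (\<Sum>x\<in>{x \<in> verts \<Gamma>. adjacent \<Gamma> x (source \<Gamma>)}. cmod (admittance \<Gamma> s x (source \<Gamma>))))"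
proof -
  interpret finite_network \<Gamma> by fact
  let ?q = "cmod s / Re s"
  let ?S = "\<Sum>x\<in>verts \<Gamma>. cmod (admittance \<Gamma> s x (source \<Gamma>))"
  obtain v where v: "dirichlet_solution \<Gamma> s v"
    using dirichlet_solution_exists[OF assms(2)] by blast
  have pos: "cmod s > 0" using assms(2) by auto
  have q: "?q \<ge> 1" using assms(2) complex_Re_le_cmod[of s] by simp
  have S: "?S = (\<Sum>x\<in>{x \<in> verts \<Gamma>. adjacent \<Gamma> x (source \<Gamma>)}.
      cmod (admittance \<Gamma> s x (source \<Gamma>)))"
    using finite_verts by (intro sum.mono_neutral_right) (auto simp: admittance_def)
  have "cmod (source_flow \<Gamma> s v) \<le> ?q * ?S"
    using cmod_source_flow_le[OF assms(2) v] assms(2) pos by (simp add: field_simps)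
  also have "\<dots> \<le> ?q\<^sup>2 * ?S"
    using q by (intro mult_right_mono self_le_power) (simp_all add: sum_nonneg)
  finally show ?thesis
    by (simp add: effective_admittance_eq[OF v] S power_divide)
qed

end
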